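(* Let $(\lambda,v)$ be an eigenpair of $M$ with $c^Hv=1$, and suppose that the matrix $$J_*=\begin{bmatrix}M(\lambda)&M'(\lambda)v\\ c^H&0\end{bmatrix}$$ is invertible. Suppose $(\mu_1,x_1),(\mu_2,x_2),\ldots$ are iterates satisfying $$\begin{bmatrix}M(\mu_k)&M'(\mu_k)x_{k+1}\\ c^H&0\end{bmatrix}\begin{bmatrix}x_{k+1}-x_k\\ \mu_{k+1}-\mu_k\end{bmatrix}=-\begin{bmatrix}M(\mu_k)x_k\\ c^Hx_k-1\end{bmatrix}$$ for all $k$, and suppose they converge to the eigenpair $(\lambda,v)$. If $(\lambda,v)$ is a simple or semi-simple eigenpair, then $(\mu_k,x_k)$ converges at least quadratically to $(\lambda,v)$.
   Context: $\Omega\subset\mathbb{C}$ is a closed set, and $M:\Omega\to\mathbb{C}^{n\times n}$ is analytic (holomorphic) in $\Omega$. An eigenpair is $(\lambda,v)$ with $\lambda\in\Omega$, $v\neq0$, $M(\lambda)v=0$. The vector $c\in\mathbb{C}^n$ is a fixed normalization vector, and the superscript $H$ denotes conjugate transpose. An eigenvalue is simple if it is a zero of $\det M(\cdot)$ of multiplicity one, and semi-simple if its algebraic multiplicity (as a zero of $\det M(\cdot)$) equals its geometric multiplicity $\dim\ker M(\lambda)$. Converging at least quadratically means that there are a constant $C$ and an index $k_0$ with $$\left\|\begin{bmatrix}x_{k+1}-v\\ \mu_{k+1}-\lambda\end{bmatrix}\right\|\le C\left\|\begin{bmatrix}x_k-v\\ \mu_k-\lambda\end{bmatrix}\right\|^2\quad\text{for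 all }k\ge k_0.$$ *)

theory Defs
  imports "HOL-Analysis.Analysis" "HOL-Complex_Analysis.Complex_Analysis"
begin

text \<open>
  Matrix-valued functions are total functions on the complex plane, of which only the germs at the
  points of \<open>\<Omega>\<close> matter: \<open>analytic_on\<close> provides a holomorphic extension to a neighbourhood of each
  point, so that the derivative also makes sense at boundary points of the closed set \<open>\<Omega>\<close>.
\<close>

definition mat_analytic_on :: "(complex \<Rightarrow> complex^'n^'n) \<Rightarrow> complex set \<Rightarrow> bool" where
  "mat_analytic_on M S \<longleftrightarrow> (\<forall>i j. (\<lambda>z. M z $ i $ j) analytic_on S)"

definition mat_deriv :: "(complex \<Rightarrow> complex^'n^'n) \<Rightarrow> complex \<Rightarrow> complex^'n^'n" where
  "mat_deriv M z = (\<chi> i j. deriv (\<lambda>w. M w $ i $ j) z)"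

text \<open>The scalar \<open>c\<^sup>H x\<close>; the library's inner product on \<open>complex^'n\<close> is only real-valued.\<close>

definition herm_prod :: "complex^'n \<Rightarrow> complex^'n \<Rightarrow> complex" where
  "herm_prod c x = (\<Sum>i\<in>UNIV. cnj (c $ i) * x $ i)"

definition eigenpair ::
  "complex set \<Rightarrow> (complex \<Rightarrow> complex^'n^'n) \<Rightarrow> complex \<Rightarrow> complex^'n \<Rightarrow> bool" where
  "eigenpair \<Omega> M l v \<longleftrightarrow> l \<in> \<Omega> \<and> v \<noteq> 0 \<and> M l *v v = 0"

text \<open>
  The first conjunct excludes functions vanishing identically near \<open>z\<close>, for which \<open>zorder\<close> is
  unspecified.
\<close>

definition zero_of_multiplicity :: "(complex \<Rightarrow> complex) \<Rightarrow> complex \<Rightarrow> nat \<Rightarrow> bool" where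
  "zero_of_multiplicity f z m \<longleftrightarrow>
     (\<exists>\<^sub>F w in at z. f w \<noteq> 0) \<and> f z = 0 \<and> zorder f z = int m"

definition simple_eigenvalue :: "(complex \<Rightarrow> complex^'n^'n) \<Rightarrow> complex \<Rightarrow> bool" where
  "simple_eigenvalue M l \<longleftrightarrow> zero_of_multiplicity (\<lambda>z. det (M z)) l 1"

text \<open>Here \<open>vec.dim\<close> is the dimension over the complex numbers, \<open>dim\<close> would be the real one.\<close>

definition semisimple_eigenvalue :: "(complex \<Rightarrow> complex^'n^'n) \<Rightarrow> complex \<Rightarrow> bool" where
  "semisimple_eigenvalue M l \<longleftrightarrow>
     zero_of_multiplicity (\<lambda>z. det (M z)) l (vec.dim {x. M l *v x = 0})"

text \<open>
  The block vector with upper part \<open>x\<close> and last entry \<open>a\<close>, and the block matrix with rows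
  \<open>[A, u]\<close> and \<open>[c\<^sup>H, 0]\<close>; the index \<open>Inr ()\<close> stands for the additional row and column.
\<close>

definition block_vec :: "complex^'n \<Rightarrow> complex \<Rightarrow> complex^('n + unit)" where
  "block_vec x a = (\<chi> i. case i of Inl p \<Rightarrow> x $ p | Inr _ \<Rightarrow> a)"

definition block_mat ::
  "complex^'n^'n \<Rightarrow> complex^'n \<Rightarrow> complex^'n \<Rightarrow> complex^('n + unit)^('n + unit)" where
  "block_mat A u c = (\<chi> i j. case i of
      Inl p \<Rightarrow> (case j of Inl q \<Rightarrow> A $ p $ q | Inr _ \<Rightarrow> u $ p)
    | Inr _ \<Rightarrow> (case j of Inl q \<Rightarrow> cnj (c $ q) | Inr _ \<Rightarrow> 0))"

definition converges_at_least_quadratically ::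
  "(nat \<Rightarrow> complex) \<Rightarrow> (nat \<Rightarrow> complex^'n) \<Rightarrow> complex \<Rightarrow> complex^'n \<Rightarrow> bool" where
  "converges_at_least_quadratically \<mu> x l v \<longleftrightarrow>
     (\<exists>C::real. \<exists>k0. \<forall>k\<ge>k0.
        norm (block_vec (x (Suc k) - v) (\<mu> (Suc k) - l))
          \<le> C * (norm (block_vec (x k - v) (\<mu> k - l)))\<^sup>2)"

end

theory Submission
  imports Defs
begin

text \<open>
  In terms of the errors \<open>d = x (Suc k) - v\<close>, \<open>e = \<mu> k - l\<close> and \<open>e' = \<mu> (Suc k) - l\<close>, the terms with
  \<open>x k\<close> cancel from a Newton step, which then says that
  \<open>(M (\<mu> k) + (e' - e) M' (\<mu> k)) x (Suc k) = 0\<close> and that \<open>c\<^sup>H d = 0\<close>. Taylor expansion about \<open>\<mu> k\<close>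
  gives \<open>M (\<mu> k) - e M' (\<mu> k) = M l + R\<close> with \<open>R = O(e\<^sup>2)\<close>. Since \<open>M l v = 0\<close>, the step
  becomes a linear system for the new error with the limiting Jacobian as its matrix:
  the image of the block vector \<open>(d, e')\<close> under \<open>J\<^sub>*\<close> is
  \<open>(- R x (Suc k) - e' (M' (\<mu> k) x (Suc k) - M' l v), 0)\<close> (lemma \<open>newton_step_error_equation\<close>).

  The first summand on the right is \<open>O(e\<^sup>2)\<close> (lemma \<open>taylor_remainder_matrix\<close>). The second one
  contains the new error \<open>e'\<close> itself, but with a factor that tends to zero. After multiplication with the inverse
  of \<open>J\<^sub>*\<close>, it is at most half of the new error for all large \<open>k\<close> and can be absorbed on the
  left. What is left is the quadratic bound.
\<close>

unbundle no fps_syntax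

section \<open>Block vectors and matrices\<close>

lemma block_mat_mult_block_vec:
  fixes A :: "complex^'n^'n"
  shows "block_mat A u c *v block_vec y a = block_vec (A *v y + a *s u) (herm_prod c y)"
proof -
  have "(block_mat A u c *v block_vec y a) $ i
      = block_vec (A *v y + a *s u) (herm_prod c y) $ i" for i
    by (cases i)
      (simp_all add: matrix_vector_mult_def block_mat_def block_vec_def herm_prod_def
        UNIV_Plus_UNIV[symmetric] sum.Plus mult.commute del: UNIV_Plus_UNIV)
  then show ?thesis by (simp add: vec_eq_iff)
qed

lemma block_vec_eq_iff: "block_vec y a = block_vec z b \<longleftrightarrow> y = z \<and> a = b"
  by (auto simp: block_vec_def vec_eq_iff split: sum.split)

lemma minus_block_vec: "- block_vec y a = block_vec (- y) (- a)"
  by (auto simp: block_vec_def vec_eq_iff split: sum.split)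

lemma norm_le_norm_block_vec: "norm a \<le> norm (block_vec y a)"
  using Finite_Cartesian_Product.norm_nth_le[of "block_vec y a" "Inr ()"] by (simp add: block_vec_def)

lemma norm_block_vec_zero: "norm (block_vec y 0) = norm y"
  by (simp add: norm_vec_def L2_set_def UNIV_Plus_UNIV[symmetric] sum.Plus block_vec_def
    del: UNIV_Plus_UNIV)

lemma norm_vector_scalar_mult:
  fixes y :: "complex^'n"
  shows "norm (a *s y) = norm a * norm y"
  by (simp add: norm_vec_def L2_set_def norm_mult power_mult_distrib
    sum_distrib_left[symmetric] real_sqrt_mult)

lemma herm_prod_diff: "herm_prod c (y - z) = herm_prod c y - herm_prod c z"
  by (simp add: herm_prod_def algebra_simps sum_subtractf)

lemma norm_matrix_vector_mult_le:
  fixes A :: "complex^'n^'m"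
  shows "norm (A *v y) \<le> (\<Sum>i\<in>UNIV. \<Sum>j\<in>UNIV. norm (A $ i $ j)) * norm y"
proof -
  have "norm (A *v y) \<le> (\<Sum>i\<in>UNIV. norm ((A *v y) $ i))"
    unfolding norm_vec_def[of "A *v y"] by (rule L2_set_le_sum) simp
  also have "\<dots> \<le> (\<Sum>i\<in>UNIV. \<Sum>j\<in>UNIV. norm (A $ i $ j) * norm y)"
    unfolding matrix_vector_mult_def
    by (auto intro!: sum_mono order_trans[OF norm_sum] mult_left_mono
      Finite_Cartesian_Product.norm_nth_le
      simp: norm_mult)
  finally show ?thesis by (simp add: sum_distrib_right)
qed

section \<open>Taylor remainders\<close>

text \<open>
  The expansion point is the variable \<open>w\<close>, and the remainder is evaluated at \<open>l\<close>. As a function of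
  \<open>w\<close> it vanishes at \<open>l\<close> and has the derivative \<open>- (w - l) f'' w\<close>, so that a bound for \<open>f''\<close> gives
  one factor \<open>norm (w - l)\<close>, and the mean value inequality on the disc the other one.
\<close>

lemma taylor_remainder_scalar:
  fixes f :: "complex \<Rightarrow> complex"
  assumes "f analytic_on {l}"
  shows "\<exists>C. \<forall>\<^sub>F w in nhds l. norm (f w - (w - l) * deriv f w - f l) \<le> C * (norm (w - l))\<^sup>2"
proof -
  from assms obtain r where r: "r > 0" and hol: "f holomorphic_on ball l r"
    unfolding analytic_on_def by auto
  define g where "g w = f w - (w - l) * deriv f w" for w
  have hol': "deriv f holomorphic_on ball l r"
    using holomorphic_deriv[OF hol open_ball] .
  have hol'': "deriv (deriv f) holomorphic_on ball l r"
    using holomorphic_deriv[OF hol' open_ball] .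
  have sub: "cball l (r/2) \<subseteq> ball l r" using r by auto
  have "bounded (deriv (deriv f) ` cball l (r/2))"
    using hol'' sub
    by (intro compact_imp_bounded compact_continuous_image)
      (auto intro: holomorphic_on_imp_continuous_on holomorphic_on_subset)
  then obtain B where B: "\<And>z. z \<in> cball l (r/2) \<Longrightarrow> norm (deriv (deriv f) z) \<le> B"
    unfolding bounded_iff by blast
  have dg: "(g has_field_derivative - (z - l) * deriv (deriv f) z) (at z)" if "z \<in> ball l r" for z
  proof -
    have "(f has_field_derivative deriv f z) (at z)"
      using holomorphic_derivI[OF hol open_ball that] .
    moreover have "(deriv f has_field_derivative deriv (deriv f) z) (at z)"
      using holomorphic_derivI[OF hol' open_ball that] .
    ultimately show ?thesis
      unfolding g_def by (auto intro!: derivative_eq_intros simp: algebra_simps)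
  qed
  have "norm (g w - g l) \<le> B * (norm (w - l))\<^sup>2" if w: "dist w l < r/2" for w
  proof -
    let ?D = "cball l (norm (w - l))"
    have D: "?D \<subseteq> cball l (r/2)" using w by (auto simp: dist_norm norm_minus_commute)
    have "norm (g w - g l) \<le> (norm (w - l) * B) * norm (w - l)"
    proof (rule field_differentiable_bound[of ?D])
      fix z assume z: "z \<in> ?D"
      then have "z \<in> cball l (r/2)" using D by blast
      then show "(g has_field_derivative - (z - l) * deriv (deriv f) z) (at z within ?D)"
        using dg sub by (blast intro: has_field_derivative_at_within)
      show "norm (- (z - l) * deriv (deriv f) z) \<le> norm (w - l) * B"
        unfolding norm_mult norm_minus_cancel
        using z B[OF \<open>z \<in> cball l (r/2)\<close>]
        by (intro mult_mono) (auto simp: dist_norm norm_minus_commute)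
    qed (auto simp: dist_norm norm_minus_commute)
    then show ?thesis by (simp add: power2_eq_square mult_ac)
  qed
  moreover have "g w - g l = f w - (w - l) * deriv f w - f l" for w
    by (simp add: g_def)
  ultimately show ?thesis
    using r unfolding eventually_nhds_metric by (metis half_gt_zero)
qed

text \<open>
  The error of expanding about \<open>w\<close>, rather than about \<open>l\<close>, is the relevant one, since a Newton step
  evaluates \<open>M\<close> and its derivative at the iterate.
\<close>

definition taylor_remainder :: "(complex \<Rightarrow> complex^'n^'n) \<Rightarrow> complex \<Rightarrow> complex \<Rightarrow> complex^'n^'n" where
  "taylor_remainder M l w =
     (\<chi> i j. M w $ i $ j - (w - l) * mat_deriv M w $ i $ j - M l $ i $ j)"

lemma taylor_remainder_mult_vec:
  "taylor_remainder M l w *v y = M w *v y - (w - l) *s (mat_deriv M w *v y) - M l *v y"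
  by (simp add: vec_eq_iff taylor_remainder_def matrix_vector_mult_def algebra_simps
    sum.distrib sum_subtractf sum_distrib_left)

lemma taylor_remainder_matrix:
  fixes M :: "complex \<Rightarrow> complex^'n^'n"
  assumes "\<And>i j. (\<lambda>z. M z $ i $ j) analytic_on {l}"
  shows "\<exists>C. \<forall>\<^sub>F w in nhds l. \<forall>y.
    norm (taylor_remainder M l w *v y) \<le> C * (norm (w - l))\<^sup>2 * norm y"
proof -
  have "\<exists>C. \<forall>\<^sub>F w in nhds l.
      norm (taylor_remainder M l w $ i $ j) \<le> C * (norm (w - l))\<^sup>2" for i j
    using taylor_remainder_scalar[OF assms[of i j]]
    by (simp add: taylor_remainder_def mat_deriv_def)
  then obtain C where "\<forall>\<^sub>F w in nhds l.
      norm (taylor_remainder M l w $ i $ j) \<le> C i j * (norm (w - l))\<^sup>2" for i j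
    by metis
  then have "\<forall>\<^sub>F w in nhds l. \<forall>i j.
      norm (taylor_remainder M l w $ i $ j) \<le> C i j * (norm (w - l))\<^sup>2"
    by (simp add: eventually_all_finite)
  then have "\<forall>\<^sub>F w in nhds l. \<forall>y. norm (taylor_remainder M l w *v y)
      \<le> (\<Sum>i\<in>UNIV. \<Sum>j\<in>UNIV. C i j) * (norm (w - l))\<^sup>2 * norm y"
  proof (eventually_elim, intro allI)
    fix w and y :: "complex^'n"
    assume C: "\<forall>i j. norm (taylor_remainder M l w $ i $ j) \<le> C i j * (norm (w - l))\<^sup>2"
    have "(\<Sum>i\<in>UNIV. \<Sum>j\<in>UNIV. norm (taylor_remainder M l w $ i $ j))
        \<le> (\<Sum>i\<in>UNIV. \<Sum>j\<in>UNIV. C i j * (norm (w - l))\<^sup>2)"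
      using C by (intro sum_mono) auto
    also have "\<dots> = (\<Sum>i\<in>UNIV. \<Sum>j\<in>UNIV. C i j) * (norm (w - l))\<^sup>2"
      by (simp add: sum_distrib_right)
    finally show "norm (taylor_remainder M l w *v y)
        \<le> (\<Sum>i\<in>UNIV. \<Sum>j\<in>UNIV. C i j) * (norm (w - l))\<^sup>2 * norm y"
      by (rule order_trans[OF norm_matrix_vector_mult_le mult_right_mono]) simp
  qed
  then show ?thesis by blast
qed

lemma tendsto_mat_deriv_mult_vec:
  fixes M :: "complex \<Rightarrow> complex^'n^'n"
  assumes an: "\<And>i j. (\<lambda>z. M z $ i $ j) analytic_on {l}"
    and "(\<mu> \<longlongrightarrow> l) F" "(y \<longlongrightarrow> v) F"
  shows "((\<lambda>k. mat_deriv M (\<mu> k) *v y k) \<longlongrightarrow> mat_deriv M l *v v) F"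
proof (rule vec_tendstoI)
  fix i
  have "((\<lambda>k. deriv (\<lambda>z. M z $ i $ j) (\<mu> k)) \<longlongrightarrow> deriv (\<lambda>z. M z $ i $ j) l) F" for j
    using analytic_at_imp_isCont[OF analytic_deriv[OF an]] assms(2)
    by (rule isCont_tendsto_compose)
  then show "((\<lambda>k. (mat_deriv M (\<mu> k) *v y k) $ i) \<longlongrightarrow> (mat_deriv M l *v v) $ i) F"
    unfolding matrix_vector_mult_def mat_deriv_def
    by (auto intro!: tendsto_intros assms(3))
qed

section \<open>Error of a Newton step\<close>

text \<open>
  The upper rows of the step cancel to \<open>M m y' + (m' - m) M' m y' = 0\<close>, because the derivative is
  applied to the new vector \<open>y'\<close>. With \<open>m' - m = (m' - l) - (m - l)\<close>, the part with \<open>m - l\<close>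
  completes \<open>M m\<close> to the first-order expansion of \<open>M l\<close>, and the term with \<open>m' - l\<close> supplies the
  last column of the Jacobian up to the difference on the right.
\<close>

lemma newton_step_error_equation:
  fixes M :: "complex \<Rightarrow> complex^'n^'n"
  assumes eig: "M l *v v = 0" and cv: "herm_prod c v = 1"
    and step: "block_mat (M m) (mat_deriv M m *v y') c *v block_vec (y' - y) (m' - m)
           = - block_vec (M m *v y) (herm_prod c y - 1)"
  shows "block_mat (M l) (mat_deriv M l *v v) c *v block_vec (y' - v) (m' - l)
    = block_vec (- (taylor_remainder M l m *v y')
        - (m' - l) *s (mat_deriv M m *v y' - mat_deriv M l *v v)) 0"
proof -
  have 1: "M m *v (y' - y) + (m' - m) *s (mat_deriv M m *v y') = - (M m *v y)"
    and 2: "herm_prod c (y' - y) = - (herm_prod c y - 1)"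
    using step by (simp_all add: block_mat_mult_block_vec minus_block_vec block_vec_eq_iff)
  have 3: "M m *v y' = - ((m' - m) *s (mat_deriv M m *v y'))"
    using 1 by (simp add: matrix_vector_mult_diff_distrib add_eq_0_iff2 algebra_simps)
  have "M l *v (y' - v) + (m' - l) *s (mat_deriv M l *v v)
      = - (taylor_remainder M l m *v y')
        - (m' - l) *s (mat_deriv M m *v y' - mat_deriv M l *v v)"
    unfolding taylor_remainder_mult_vec 3 matrix_vector_mult_diff_distrib eig
    by (simp add: vec_eq_iff algebra_simps)
  moreover have "herm_prod c (y' - v) = 0"
    using 2 cv by (simp add: herm_prod_diff)
  ultimately show ?thesis
    by (simp only: block_mat_mult_block_vec)
qed

lemma invertible_norm_bound:
  fixes A :: "complex^'n^'n"
  assumes "invertible A"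
  shows "\<exists>K>0. \<forall>y. norm y \<le> K * norm (A *v y)"
proof -
  obtain B where B: "B ** A = mat 1"
    using assms unfolding invertible_def by blast
  define K where "K = (\<Sum>i\<in>UNIV. \<Sum>j\<in>UNIV. norm (B $ i $ j))"
  have "norm y \<le> (K + 1) * norm (A *v y)" for y
  proof -
    have "norm y = norm (B *v (A *v y))"
      by (simp add: matrix_vector_mul_assoc B)
    also have "\<dots> \<le> K * norm (A *v y)"
      unfolding K_def by (rule norm_matrix_vector_mult_le)
    also have "\<dots> \<le> (K + 1) * norm (A *v y)"
      by (simp add: mult_right_mono)
    finally show ?thesis .
  qed
  moreover have "K + 1 > 0"
    unfolding K_def by (intro add_nonneg_pos sum_nonneg) auto
  ultimately show ?thesis by blast
qed

theorem theorem3p4: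
  fixes \<Omega> :: "complex set"
    and M :: "complex \<Rightarrow> complex^'n^'n"
    and c v :: "complex^'n"
    and l :: complex
    and \<mu> :: "nat \<Rightarrow> complex"
    and x :: "nat \<Rightarrow> complex^'n"
  assumes "closed \<Omega>"
    and "mat_analytic_on M \<Omega>"
    and "eigenpair \<Omega> M l v"
    and "herm_prod c v = 1"
    and "invertible (block_mat (M l) (mat_deriv M l *v v) c)"
    and "\<And>k. k \<ge> 1 \<Longrightarrow> \<mu> k \<in> \<Omega>"
    and "\<And>k. k \<ge> 1 \<Longrightarrow>
           block_mat (M (\<mu> k)) (mat_deriv M (\<mu> k) *v x (Suc k)) c
             *v block_vec (x (Suc k) - x k) (\<mu> (Suc k) - \<mu> k)
           = - block_vec (M (\<mu> k) *v x k) (herm_prod c (x k) - 1)"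
    and "\<mu> \<longlonglongrightarrow> l"
    and "x \<longlonglongrightarrow> v"
    and "simple_eigenvalue M l \<or> semisimple_eigenvalue M l"
  shows "converges_at_least_quadratically \<mu> x l v"
proof -
  have an: "(\<lambda>z. M z $ i $ j) analytic_on {l}" for i j
    using assms(2,3) unfolding mat_analytic_on_def eigenpair_def
    by (blast intro: analytic_on_subset)
  have eig: "M l *v v = 0"
    using assms(3) by (simp add: eigenpair_def)
  let ?E = "\<lambda>k. norm (block_vec (x k - v) (\<mu> k - l))"
  let ?\<eta> = "\<lambda>k. mat_deriv M (\<mu> k) *v x (Suc k) - mat_deriv M l *v v"
  obtain K where "K > 0" and K: "\<And>z. norm z
      \<le> K * norm (block_mat (M l) (mat_deriv M l *v v) c *v z)"
    using invertible_norm_bound[OF assms(5)] by blast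
  obtain C0 where "\<forall>\<^sub>F w in nhds l. \<forall>y.
      norm (taylor_remainder M l w *v y) \<le> C0 * (norm (w - l))\<^sup>2 * norm y"
    using taylor_remainder_matrix[OF an] by blast
  then have R: "\<forall>\<^sub>F k in sequentially. \<forall>y.
      norm (taylor_remainder M l (\<mu> k) *v y) \<le> C0 * (norm (\<mu> k - l))\<^sup>2 * norm y"
    using assms(8) by (auto dest: eventually_compose_filterlim)
  obtain B where B: "\<And>k. norm (x k) \<le> B"
    using convergent_imp_Bseq[OF convergentI[OF assms(9)]] unfolding Bseq_def by blast
  have "?\<eta> \<longlonglongrightarrow> 0"
    using tendsto_mat_deriv_mult_vec[OF an assms(8) LIMSEQ_Suc[OF assms(9)]]
    by (simp add: LIM_zero_iff)
  then have \<eta>: "\<forall>\<^sub>F k in sequentially. norm (?\<eta> k) < 1 / (2 * K)"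
    using \<open>K > 0\<close> by (auto dest!: tendstoD[of _ _ _ "1 / (2 * K)"])
  \<comment> \<open>The bound \<open>1 / (2 * K)\<close> makes the term with the new error at most half of that error after
      multiplication with \<open>K\<close>; moving it to the left doubles the other constant.\<close>
  have "\<forall>\<^sub>F k in sequentially. ?E (Suc k) \<le> 2 * K * \<bar>C0\<bar> * B * (?E k)\<^sup>2"
    using R \<eta> eventually_ge_at_top[of 1]
  proof eventually_elim
    fix k :: nat
    assume R: "\<forall>y. norm (taylor_remainder M l (\<mu> k) *v y) \<le> C0 * (norm (\<mu> k - l))\<^sup>2 * norm y"
      and \<eta>: "norm (?\<eta> k) < 1 / (2 * K)" and "1 \<le> k"
    let ?r = "taylor_remainder M l (\<mu> k) *v x (Suc k)"
    have "norm ?r \<le> C0 * (norm (\<mu> k - l))\<^sup>2 * norm (x (Suc k))"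
      using R by blast
    also have "\<dots> \<le> \<bar>C0\<bar> * (?E k)\<^sup>2 * B"
      using B[of "Suc k"] norm_le_norm_block_vec[of "\<mu> k - l" "x k - v"]
      by (intro mult_mono power_mono) auto
    finally have r: "norm ?r \<le> \<bar>C0\<bar> * (?E k)\<^sup>2 * B" .
    have "norm ((\<mu> (Suc k) - l) *s ?\<eta> k) = norm (\<mu> (Suc k) - l) * norm (?\<eta> k)"
      by (rule norm_vector_scalar_mult)
    also have "\<dots> \<le> ?E (Suc k) * (1 / (2 * K))"
      using \<eta> norm_le_norm_block_vec[of "\<mu> (Suc k) - l" "x (Suc k) - v"]
      by (intro mult_mono) auto
    finally have s: "norm ((\<mu> (Suc k) - l) *s ?\<eta> k) \<le> ?E (Suc k) * (1 / (2 * K))" .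
    have "?E (Suc k) \<le> K * norm (- ?r - (\<mu> (Suc k) - l) *s ?\<eta> k)"
      using K[of "block_vec (x (Suc k) - v) (\<mu> (Suc k) - l)"]
        newton_step_error_equation[OF eig assms(4) assms(7)[OF \<open>1 \<le> k\<close>]]
      by (simp add: norm_block_vec_zero)
    also have "\<dots> \<le> K * (\<bar>C0\<bar> * (?E k)\<^sup>2 * B + ?E (Suc k) * (1 / (2 * K)))"
      using \<open>K > 0\<close> norm_triangle_ineq4[of "- ?r" "(\<mu> (Suc k) - l) *s ?\<eta> k"] r s
      by (intro mult_left_mono) auto
    also have "\<dots> = K * \<bar>C0\<bar> * B * (?E k)\<^sup>2 + ?E (Suc k) / 2"
      using \<open>K > 0\<close> by (simp add: field_simps)
    finally show "?E (Suc k) \<le> 2 * K * \<bar>C0\<bar> * B * (?E k)\<^sup>2"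
      by simp
  qed
  then show ?thesis
    unfolding converges_at_least_quadratically_def eventually_sequentially by blast
qed

end
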